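(* Let $S=\langle n_1,n_2,n_3,n_4\rangle$ be a 4-generated pseudo-symmetric numerical semigroup with $n_1<n_2<n_3<n_4$, with associated integers $\alpha_1,\alpha_2,\alpha_3,\alpha_4,\alpha_{21}$, and suppose $\alpha_2>\alpha_{21}+1$. Put $s_{-1}=0$ and, for $j=0,1,\dots,\alpha_4-1$, let $s_j$ be the smallest non-negative integer with $$((\alpha_4-1)s_j+j)\alpha_2+\alpha_4-j< s_j\alpha_1+((\alpha_4-1)s_j+j+1)\alpha_{21}+\alpha_3-s_j .$$ Then a standard basis for $I_S$ is $$G=\{f_{1,j}\;:\;0\le j\le \alpha_4-1\}\cup\{f_2,f_3,f_4\}\cup\{g_{j,i_j}\;:\;0\le j\le\alpha_4-1,\ i_j=s_{j-1},s_{j-1}+1,\dots,s_j\},$$ where $$f_{1,j}=X_1^{\alpha_1+j\alpha_{21}}-X_2^{j\alpha_2}X_3X_4^{\alpha_4-(j+1)},\qquad f_2=X_2^{\alpha_2}-X_1^{\alpha_{21}}X_4,$$ $$f_3=X_3^{\alpha_3}-X_1^{\alpha_1-\alpha_{21}-1}X_2,\qquad f_4=X_4^{\alpha_4}-X_1X_2^{\alpha_2-1}X_3^{\alpha_3-1},$$ $$g_{j,i_j}=X_2^{((\alpha_4-1)i_j+j)\alpha_2+1}X_4^{\alpha_4-(j+1)}-X_1^{i_j\alpha_1+((\alpha_4-1)i_j+j+1)\alpha_{21}+1}X_3^{\alpha_3-(i_j+1)}.$$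
   Context: $K$ is an algebraically closed field, $A=K[X_1,X_2,X_3,X_4]$. For positive integers $n_1<n_2<n_3<n_4$ with $\gcd=1$, $S=\langle n_1,\dots,n_4\rangle=\{\sum u_in_i: u_i\in\mathbb N\}$ and $I_S$ is the kernel of the $K$-algebra map $A\to K[t]$, $X_i\mapsto t^{n_i}$. By Komeda, a 4-generated semigroup $S$ is pseudo-symmetric if and only if there are integers $\alpha_i>1$ ($1\le i\le 4$) and $\alpha_{21}$ with $0<\alpha_{21}<\alpha_1-1$ such that $n_1=\alpha_2\alpha_3(\alpha_4-1)+1$, $n_2=\alpha_{21}\alpha_3\alpha_4+(\alpha_1-\alpha_{21}-1)(\alpha_3-1)+\alpha_3$, $n_3=\alpha_1\alpha_4+(\alpha_1-\alpha_{21}-1)(\alpha_2-1)(\alpha_4-1)-\alpha_4+1$, $n_4=\alpha_1\alpha_2(\alpha_3-1)+\alpha_{21}(\alpha_2-1)+\alpha_2$. These are the integers $\alpha_i,\alpha_{21}$ used in the claim. In this case $I_S$ is generated by $X_1^{\alpha_1}-X_3X_4^{\alpha_4-1}$, $X_2^{\alpha_2}-X_1^{\alpha_{21}}X_4$, $X_3^{\alpha_3}-X_1^{\alpha_1-\alpha_{21}-1}X_2$, $X_4^{\alpha_4}-X_1X_2^{\alpha_2-1}X_3^{\alpha_3-1}$, $X_1^{\alpha_{21}+1}X_3^{\alpha_3-1}-X_2X_4^{\alpha_4-1}$. Monomial ordering: a local monomial ordering in which monomials of smaller total degree are larger, so that the leading monomial ${\rm LM}(f)$ has the least total degree among the monomials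 of $f$; for $0\le i<s_j$ the leading monomial of $g_{j,i}$ is taken to be its monomial in $X_1,X_3$ (by definition of $s_j$ its degree is at most that of the other monomial, so this is a condition only in case of equal degrees). A finite set $G\subset I_S$ is a standard basis of $I_S$ if for each nonzero $f\in I_S$ the monomial ${\rm LM}(f)$ is divisible by ${\rm LM}(g)$ for some $g\in G$. *)

theory Defs
  imports "HOL-Library.Poly_Mapping" "HOL-Computational_Algebra.Polynomial"
begin

section \<open>Numerical semigroups generated by four elements\<close>

datatype var = V1 | V2 | V3 | V4

lemma UNIV_var: "(UNIV :: var set) = {V1, V2, V3, V4}"
  by (auto intro: var.exhaust)

instance var :: finite
  by standard (simp add: UNIV_var)

fun tuple :: "'b \<Rightarrow> 'b \<Rightarrow> 'b \<Rightarrow> 'b \<Rightarrow> var \<Rightarrow> 'b" where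
  "tuple a b c d V1 = a"
| "tuple a b c d V2 = b"
| "tuple a b c d V3 = c"
| "tuple a b c d V4 = d"

definition semigroup_gen :: "(var \<Rightarrow> nat) \<Rightarrow> var set \<Rightarrow> nat set" where
  "semigroup_gen n V = {\<Sum>v\<in>V. u v * n v | u :: var \<Rightarrow> nat. True}"

text \<open>``4-generated'' is read as: the four generators form a minimal generating system.\<close>

definition minimally_generated :: "(var \<Rightarrow> nat) \<Rightarrow> bool" where
  "minimally_generated n \<longleftrightarrow> (\<forall>v. n v \<notin> semigroup_gen n (UNIV - {v}))"

definition numerical_semigroup :: "nat set \<Rightarrow> bool" where
  "numerical_semigroup S \<longleftrightarrow> 0 \<in> S \<and> (\<forall>x\<in>S. \<forall>y\<in>S. x + y \<in> S) \<and> finite (- S)"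

definition frobenius :: "nat set \<Rightarrow> nat" where
  "frobenius S = Max (- S)"

text \<open>Usually stated for all integers \<open>x \<notin> S\<close>; negative \<open>x\<close> satisfy the condition automatically,
  and a natural number outside \<open>S\<close> is at most the Frobenius number, so the subtraction is exact.\<close>

definition pseudo_symmetric :: "nat set \<Rightarrow> bool" where
  "pseudo_symmetric S \<longleftrightarrow> numerical_semigroup S \<and> S \<noteq> UNIV \<and> even (frobenius S) \<and>
     (\<forall>x. x \<notin> S \<longrightarrow> 2 * x \<noteq> frobenius S \<longrightarrow> frobenius S - x \<in> S)"

text \<open>Komeda's parametrisation. The bounds on the parameters make every subtraction of natural
  numbers exact.\<close>

definition komeda_parameters ::
    "(var \<Rightarrow> nat) \<Rightarrow> nat \<Rightarrow> nat \<Rightarrow> nat \<Rightarrow> nat \<Rightarrow> nat \<Rightarrow> bool" where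
  "komeda_parameters n a1 a2 a3 a4 a21 \<longleftrightarrow>
     1 < a1 \<and> 1 < a2 \<and> 1 < a3 \<and> 1 < a4 \<and> 0 < a21 \<and> a21 < a1 - 1 \<and>
     n V1 = a2 * a3 * (a4 - 1) + 1 \<and>
     n V2 = a21 * a3 * a4 + (a1 - a21 - 1) * (a3 - 1) + a3 \<and>
     n V3 = a1 * a4 + (a1 - a21 - 1) * (a2 - 1) * (a4 - 1) - a4 + 1 \<and>
     n V4 = a1 * a2 * (a3 - 1) + a21 * (a2 - 1) + a2"


section \<open>Polynomials in four variables and toric ideals\<close>

type_synonym mon = "var \<Rightarrow>\<^sub>0 nat"
type_synonym 'a mpoly4 = "mon \<Rightarrow>\<^sub>0 'a"

definition X :: "var \<Rightarrow> 'a::comm_ring_1 mpoly4" where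
  "X v = Poly_Mapping.single (Poly_Mapping.single v 1) 1"

text \<open>The algebra homomorphism into \<open>'a poly\<close> sending the variable \<open>v\<close> to \<open>x v\<close>.\<close>

definition subst_hom :: "(var \<Rightarrow> 'a::comm_ring_1 poly) \<Rightarrow> 'a mpoly4 \<Rightarrow> 'a poly" where
  "subst_hom x p =
     (\<Sum>m\<in>Poly_Mapping.keys p. [:Poly_Mapping.lookup p m:] * (\<Prod>v\<in>UNIV. x v ^ Poly_Mapping.lookup m v))"

definition toric_ideal :: "(var \<Rightarrow> nat) \<Rightarrow> 'a::comm_ring_1 mpoly4 set" where
  "toric_ideal n = {p. subst_hom (\<lambda>v. [:0, 1:] ^ n v) p = 0}"


section \<open>Local monomial orderings and standard bases\<close>

definition tdeg :: "mon \<Rightarrow> nat" where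
  "tdeg m = (\<Sum>v\<in>UNIV. Poly_Mapping.lookup m v)"

text \<open>An ordering is given by its strict part: \<open>lt a b\<close> means that \<open>a\<close> is smaller than \<open>b\<close>.\<close>

definition monomial_ordering :: "(mon \<Rightarrow> mon \<Rightarrow> bool) \<Rightarrow> bool" where
  "monomial_ordering lt \<longleftrightarrow> irreflp lt \<and> transp lt \<and> totalp lt \<and>
     (\<forall>a b c. lt a b \<longrightarrow> lt (a + c) (b + c))"

text \<open>The degree condition makes \<open>1\<close> the largest monomial, i.e. the ordering is local.\<close>

definition local_degree_ordering :: "(mon \<Rightarrow> mon \<Rightarrow> bool) \<Rightarrow> bool" where
  "local_degree_ordering lt \<longleftrightarrow> monomial_ordering lt \<and>
     (\<forall>a b. tdeg a < tdeg b \<longrightarrow> lt b a)"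

text \<open>Meaningful for \<open>f \<noteq> 0\<close>.\<close>

definition LM :: "(mon \<Rightarrow> mon \<Rightarrow> bool) \<Rightarrow> 'a::zero mpoly4 \<Rightarrow> mon" where
  "LM lt f = (THE m. m \<in> Poly_Mapping.keys f \<and> (\<forall>m'\<in>Poly_Mapping.keys f. m' \<noteq> m \<longrightarrow> lt m' m))"

definition mon_dvd :: "mon \<Rightarrow> mon \<Rightarrow> bool" where
  "mon_dvd m m' \<longleftrightarrow> (\<exists>c. m' = m + c)"

definition standard_basis ::
    "(mon \<Rightarrow> mon \<Rightarrow> bool) \<Rightarrow> 'a::zero mpoly4 set \<Rightarrow> 'a mpoly4 set \<Rightarrow> bool" where
  "standard_basis lt I G \<longleftrightarrow> finite G \<and> G \<subseteq> I \<and>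
     (\<forall>f\<in>I. f \<noteq> 0 \<longrightarrow> (\<exists>g\<in>G. g \<noteq> 0 \<and> mon_dvd (LM lt g) (LM lt f)))"


section \<open>The numbers \<open>s\<^sub>j\<close> and the proposed standard basis\<close>

text \<open>The inequality is an inequality of integers, as \<open>s\<close> is not bounded by \<open>\<alpha>\<^sub>3\<close> a priori.\<close>

definition s_num :: "nat \<Rightarrow> nat \<Rightarrow> nat \<Rightarrow> nat \<Rightarrow> nat \<Rightarrow> nat \<Rightarrow> nat" where
  "s_num a1 a2 a3 a4 a21 j = (LEAST s.
     ((int a4 - 1) * int s + int j) * int a2 + int a4 - int j
     < int s * int a1 + ((int a4 - 1) * int s + int j + 1) * int a21 + int a3 - int s)"

text \<open>\<open>s_prev j\<close> is \<open>s\<^bsub>j-1\<^esub>\<close>, where \<open>s\<^bsub>-1\<^esub> = 0\<close>.\<close>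

definition s_prev :: "nat \<Rightarrow> nat \<Rightarrow> nat \<Rightarrow> nat \<Rightarrow> nat \<Rightarrow> nat \<Rightarrow> nat" where
  "s_prev a1 a2 a3 a4 a21 j = (if j = 0 then 0 else s_num a1 a2 a3 a4 a21 (j - 1))"

definition f1 :: "nat \<Rightarrow> nat \<Rightarrow> nat \<Rightarrow> nat \<Rightarrow> nat \<Rightarrow> nat \<Rightarrow> 'a::comm_ring_1 mpoly4" where
  "f1 a1 a2 a3 a4 a21 j =
     X V1 ^ (a1 + j * a21) - X V2 ^ (j * a2) * X V3 * X V4 ^ (a4 - (j + 1))"

definition f2 :: "nat \<Rightarrow> nat \<Rightarrow> nat \<Rightarrow> nat \<Rightarrow> nat \<Rightarrow> 'a::comm_ring_1 mpoly4" where
  "f2 a1 a2 a3 a4 a21 = X V2 ^ a2 - X V1 ^ a21 * X V4"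

definition f3 :: "nat \<Rightarrow> nat \<Rightarrow> nat \<Rightarrow> nat \<Rightarrow> nat \<Rightarrow> 'a::comm_ring_1 mpoly4" where
  "f3 a1 a2 a3 a4 a21 = X V3 ^ a3 - X V1 ^ (a1 - a21 - 1) * X V2"

definition f4 :: "nat \<Rightarrow> nat \<Rightarrow> nat \<Rightarrow> nat \<Rightarrow> nat \<Rightarrow> 'a::comm_ring_1 mpoly4" where
  "f4 a1 a2 a3 a4 a21 = X V4 ^ a4 - X V1 * X V2 ^ (a2 - 1) * X V3 ^ (a3 - 1)"

text \<open>For \<open>j < \<alpha>\<^sub>4\<close> and \<open>i \<le> s\<^sub>j\<close> the subtractions are exact: \<open>n\<^sub>1\<close> being the smallest generator,
  the inequality defining \<open>s\<^sub>j\<close> holds at \<open>\<alpha>\<^sub>3 - 1\<close>, so \<open>s\<^sub>j < \<alpha>\<^sub>3\<close>.\<close>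

definition g_exp1 :: "nat \<Rightarrow> nat \<Rightarrow> nat \<Rightarrow> nat \<Rightarrow> nat \<Rightarrow> nat \<Rightarrow> nat \<Rightarrow> nat" where
  "g_exp1 a1 a2 a3 a4 a21 j i = i * a1 + ((a4 - 1) * i + j + 1) * a21 + 1"

definition g :: "nat \<Rightarrow> nat \<Rightarrow> nat \<Rightarrow> nat \<Rightarrow> nat \<Rightarrow> nat \<Rightarrow> nat \<Rightarrow> 'a::comm_ring_1 mpoly4" where
  "g a1 a2 a3 a4 a21 j i =
     X V2 ^ (((a4 - 1) * i + j) * a2 + 1) * X V4 ^ (a4 - (j + 1))
     - X V1 ^ g_exp1 a1 a2 a3 a4 a21 j i * X V3 ^ (a3 - (i + 1))"

definition G_set :: "nat \<Rightarrow> nat \<Rightarrow> nat \<Rightarrow> nat \<Rightarrow> nat \<Rightarrow> 'a::comm_ring_1 mpoly4 set" where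
  "G_set a1 a2 a3 a4 a21 =
     {f1 a1 a2 a3 a4 a21 j | j. j \<le> a4 - 1}
     \<union> {f2 a1 a2 a3 a4 a21, f3 a1 a2 a3 a4 a21, f4 a1 a2 a3 a4 a21}
     \<union> {g a1 a2 a3 a4 a21 j i | j i. j \<le> a4 - 1 \<and>
          s_prev a1 a2 a3 a4 a21 j \<le> i \<and> i \<le> s_num a1 a2 a3 a4 a21 j}"

end

theory Submission
  imports Defs "HOL-Library.FuncSet"
begin

text \<open>
  Grade \<open>K[X\<^sub>1,\<dots>,X\<^sub>4]\<close> by giving \<open>X\<^sub>v\<close> the weight \<open>n v\<close>. A polynomial lies in the toric ideal iff,
  in each weight, its coefficients add up to zero. Hence the leading monomial of a nonzero
  element of the ideal shares its weight with a smaller monomial, and a finite subset \<open>G\<close> of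
  the ideal is a standard basis as soon as \<^emph>\<open>among any two distinct monomials of equal
  weight at least one is divisible by a leading monomial of \<open>G\<close>\<close>
  (\<open>standard_basis_toricI\<close>). So suppose that neither of two monomials of equal weight is
  divisible by a leading monomial; they have to coincide.

  The difference of two exponent vectors of equal weight is an integer combination
  \<open>p v\<^sub>1 + q v\<^sub>2 + r v\<^sub>3\<close> of the exponent vectors that \<open>f\<^bsub>1,0\<^esub>\<close>, \<open>f\<^sub>2\<close> and \<open>f\<^sub>3\<close> define up to
  sign (\<open>relation_lattice\<close>): the maximal minors of these three vectors are \<open>\<plusminus> n v\<close>, and their
  greatest common divisor is \<open>1\<close>. Exchanging the two monomials, assume \<open>p \<ge> 0\<close>. If \<open>p = 0\<close>, the
  bound \<open>X\<^sub>3\<^bsup>\<alpha>\<^sub>3\<^esup>\<close> forces \<open>r = 0\<close>, and a multiple of \<open>v\<^sub>2\<close> is caught by \<open>f\<^sub>2\<close>. If \<open>p > 0\<close>, the bounds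
  \<open>X\<^sub>3\<^bsup>\<alpha>\<^sub>3\<^esup>\<close>, \<open>X\<^sub>4\<^bsup>\<alpha>\<^sub>4\<^esup>\<close> and \<open>X\<^sub>1\<^bsup>\<alpha>\<^sub>2\<^sub>1\<^esup>X\<^sub>4\<close> determine all signs, and
  there is a \<open>j\<close> such that either \<open>LM f\<^bsub>1,j\<^esub>\<close> divides the second monomial, or the two
  monomials are multiples of the two monomials of some \<open>g\<^bsub>j,i\<^esub>\<close> (\<open>positive_case\<close>). In the last
  case \<open>i \<ge> s\<^sub>j\<close> means that the \<open>X\<^sub>2,X\<^sub>4\<close>-monomial is a multiple of \<open>LM g\<^bsub>j,s\<^sub>j\<^esub>\<close>, while \<open>i < s\<^sub>j\<close>
  means that the \<open>X\<^sub>1,X\<^sub>3\<close>-monomial is a multiple of \<open>LM g\<^bsub>j',i\<^esub>\<close> for the least \<open>j'\<close> with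
  \<open>i < s\<^bsub>j'\<^esub>\<close>.
\<close>

section \<open>Standard bases of toric ideals\<close>

definition weight :: "(var \<Rightarrow> nat) \<Rightarrow> mon \<Rightarrow> nat" where
  "weight n m = (\<Sum>v\<in>UNIV. Poly_Mapping.lookup m v * n v)"

lemma weight_add: "weight n (a + b) = weight n a + weight n b"
  by (simp add: weight_def lookup_add sum.distrib algebra_simps)

lemma finite_weight_fibre:
  assumes "\<And>v. 0 < n v"
  shows "finite {m. weight n m = w}"
proof -
  have "Poly_Mapping.lookup m v \<le> w" if "weight n m = w" for m v
  proof -
    have "Poly_Mapping.lookup m v \<le> Poly_Mapping.lookup m v * n v"
      using assms[of v] by simp
    also have "\<dots> \<le> weight n m"
      unfolding weight_def by (rule member_le_sum) auto
    finally show ?thesis using that by simp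
  qed
  then have "Poly_Mapping.lookup ` {m. weight n m = w} \<subseteq> PiE UNIV (\<lambda>_. {..w})"
    by (auto simp: PiE_UNIV_domain)
  then have "finite (Poly_Mapping.lookup ` {m. weight n m = w})"
    by (rule finite_subset) (simp add: finite_PiE)
  then show ?thesis
    by (rule finite_imageD) (simp add: inj_on_def lookup_inject)
qed

lemma coeff_subst_hom:
  "coeff (subst_hom (\<lambda>v. [:0, 1:] ^ n v) p) w =
     (\<Sum>m\<in>Poly_Mapping.keys p. if weight n m = w then Poly_Mapping.lookup p m else 0)"
proof -
  have "[:c:] * (\<Prod>v\<in>UNIV. ([:0, 1:] ^ n v) ^ Poly_Mapping.lookup m v) = monom c (weight n m)"
    for c :: 'a and m
  proof -
    have "(\<Prod>v\<in>UNIV. ([:0, 1::'a:] ^ n v) ^ Poly_Mapping.lookup m v) = [:0, 1:] ^ weight n m"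
      unfolding weight_def power_sum
      by (rule prod.cong) (simp_all add: power_mult[symmetric] mult.commute)
    then show ?thesis by (simp add: monom_altdef)
  qed
  then show ?thesis by (simp add: subst_hom_def coeff_sum)
qed

text \<open>The coefficients of \<open>f\<close> in the weight of \<open>m\<close> add up to zero, so that of \<open>m\<close> must be cancelled.\<close>

lemma toric_ideal_cancellation:
  assumes "f \<in> toric_ideal n" and m: "m \<in> Poly_Mapping.keys f"
  shows "\<exists>m'\<in>Poly_Mapping.keys f. m' \<noteq> m \<and> weight n m' = weight n m"
proof (rule ccontr)
  assume "\<not> ?thesis"
  then have "(if weight n m' = weight n m then Poly_Mapping.lookup f m' else 0)
      = (if m' = m then Poly_Mapping.lookup f m else 0)" if "m' \<in> Poly_Mapping.keys f" for m'
    using that by auto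
  then have "coeff (subst_hom (\<lambda>v. [:0, 1:] ^ n v) f) (weight n m)
      = (\<Sum>m'\<in>Poly_Mapping.keys f. if m' = m then Poly_Mapping.lookup f m else 0)"
    unfolding coeff_subst_hom by (rule sum.cong[OF refl])
  also have "\<dots> = Poly_Mapping.lookup f m" using m by simp
  finally have "Poly_Mapping.lookup f m = 0" using assms(1) by (simp add: toric_ideal_def)
  then show False using m by (simp add: in_keys_iff)
qed

lemma monomial_ordering_asym: "monomial_ordering lt \<Longrightarrow> lt x y \<Longrightarrow> \<not> lt y x"
  unfolding monomial_ordering_def by (blast dest: irreflpD transpD)

lemma finite_total_minimal:
  assumes ord: "monomial_ordering lt" and M: "finite M" "M \<noteq> {}"
  obtains m where "m \<in> M" "\<And>m'. m' \<in> M \<Longrightarrow> m' \<noteq> m \<Longrightarrow> lt m m'"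
proof -
  have trans: "transp lt" using ord by (simp add: monomial_ordering_def)
  have "\<exists>m\<in>M. \<forall>m'\<in>M. m' \<noteq> m \<longrightarrow> lt m m'"
    using M
  proof (induction rule: finite_ne_induct)
    case (insert x F)
    then obtain m where m: "m \<in> F" "\<forall>m'\<in>F. m' \<noteq> m \<longrightarrow> lt m m'" by blast
    consider "lt x m" | "lt m x" using insert m ord
      by (metis monomial_ordering_def totalpD)
    then show ?case
    proof cases
      case 1
      have "lt x m'" if "m' \<in> F" for m'
        using 1 m(2) that transpD[OF trans] by (cases "m' = m") blast+
      then show ?thesis by blast
    next
      case 2
      then show ?thesis using m by blast
    qed
  qed simp
  then show ?thesis using that by blast
qed

lemma monomial_ordering_converse: "monomial_ordering lt \<Longrightarrow> monomial_ordering lt\<inverse>\<inverse>"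
  by (simp add: monomial_ordering_def)

lemma LM_eqI:
  assumes "monomial_ordering lt" "m \<in> Poly_Mapping.keys f"
    and "\<And>m'. m' \<in> Poly_Mapping.keys f \<Longrightarrow> m' \<noteq> m \<Longrightarrow> lt m' m"
  shows "LM lt f = m"
  unfolding LM_def
proof (rule the_equality)
  fix m' assume m': "m' \<in> Poly_Mapping.keys f \<and> (\<forall>m''\<in>Poly_Mapping.keys f. m'' \<noteq> m' \<longrightarrow> lt m'' m')"
  show "m' = m"
  proof (rule ccontr)
    assume "m' \<noteq> m"
    then have "lt m m'" "lt m' m" using m' assms(2,3) by auto
    then show False using monomial_ordering_asym[OF assms(1)] by simp
  qed
qed (use assms in auto)

lemma LM_properties:
  assumes "monomial_ordering lt" "f \<noteq> 0"
  shows LM_in_keys: "LM lt f \<in> Poly_Mapping.keys f"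
    and LM_greatest: "\<And>m. m \<in> Poly_Mapping.keys f \<Longrightarrow> m \<noteq> LM lt f \<Longrightarrow> lt m (LM lt f)"
proof -
  obtain m where m: "m \<in> Poly_Mapping.keys f"
    "\<And>m'. m' \<in> Poly_Mapping.keys f \<Longrightarrow> m' \<noteq> m \<Longrightarrow> lt m' m"
    using finite_total_minimal[OF monomial_ordering_converse[OF assms(1)], of "Poly_Mapping.keys f"]
      assms(2) by auto
  then have "LM lt f = m" by (rule LM_eqI[OF assms(1)])
  with m show "LM lt f \<in> Poly_Mapping.keys f"
    "\<And>m. m \<in> Poly_Mapping.keys f \<Longrightarrow> m \<noteq> LM lt f \<Longrightarrow> lt m (LM lt f)" by auto
qed

text \<open>
  The smallest monomial of a given weight is not a multiple of \<open>LM g\<close> for any nonzero \<open>g\<close> in the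
  ideal, since replacing \<open>LM g\<close> by another monomial of \<open>g\<close> of the same weight makes it smaller. So
  the hypothesis, applied to a leading monomial and the smallest monomial of its weight, has to
  produce a divisor of the former.
\<close>

lemma standard_basis_toricI:
  assumes ord: "monomial_ordering lt" and pos: "\<And>v. 0 < n v"
    and fin: "finite G" and sub: "G \<subseteq> toric_ideal n"
    and distinguish: "\<And>m m'. weight n m = weight n m' \<Longrightarrow> m \<noteq> m' \<Longrightarrow>
      \<exists>g\<in>G. g \<noteq> 0 \<and> (mon_dvd (LM lt g) m \<or> mon_dvd (LM lt g) m')"
  shows "standard_basis lt (toric_ideal n) G"
  unfolding standard_basis_def
proof (intro conjI fin sub ballI impI)
  fix f :: "'a mpoly4" assume f: "f \<in> toric_ideal n" "f \<noteq> 0"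
  define w where "w = weight n (LM lt f)"
  have "{m. weight n m = w} \<noteq> {}" by (auto simp: w_def)
  from finite_total_minimal[OF ord finite_weight_fibre[OF pos] this]
  obtain b where b: "weight n b = w" "\<And>m. weight n m = w \<Longrightarrow> m \<noteq> b \<Longrightarrow> lt b m"
    by simp metis
  note asym = monomial_ordering_asym[OF ord]
  have b_normal: "\<not> mon_dvd (LM lt g) b" if g: "g \<in> G" "g \<noteq> 0" for g
  proof
    assume "mon_dvd (LM lt g) b"
    then obtain c where c: "b = LM lt g + c" unfolding mon_dvd_def by blast
    have "g \<in> toric_ideal n" using sub g(1) by blast
    from toric_ideal_cancellation[OF this LM_in_keys[OF ord g(2)]]
    obtain u where u: "u \<in> Poly_Mapping.keys g" "u \<noteq> LM lt g" "weight n u = weight n (LM lt g)" by blast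
    then have "lt u (LM lt g)" using LM_greatest[OF ord g(2)] by blast
    then have "lt (u + c) b" unfolding c using ord by (simp add: monomial_ordering_def)
    moreover have "weight n (u + c) = w" using u b(1) c by (simp add: weight_add)
    ultimately show False using b(2) asym by metis
  qed
  from toric_ideal_cancellation[OF f(1) LM_in_keys[OF ord f(2)]]
  obtain m' where m': "m' \<in> Poly_Mapping.keys f" "m' \<noteq> LM lt f" "weight n m' = w"
    unfolding w_def by blast
  then have "lt m' (LM lt f)" using LM_greatest[OF ord f(2)] by blast
  then have "LM lt f \<noteq> b" using b(2) m' asym by metis
  then show "\<exists>g\<in>G. g \<noteq> 0 \<and> mon_dvd (LM lt g) (LM lt f)"
    using distinguish[of "LM lt f" b] b(1) b_normal by (auto simp: w_def)
qed

section \<open>Binomials\<close>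

definition mon4 :: "nat \<Rightarrow> nat \<Rightarrow> nat \<Rightarrow> nat \<Rightarrow> mon" where
  "mon4 a b c d = Poly_Mapping.single V1 a + Poly_Mapping.single V2 b
     + Poly_Mapping.single V3 c + Poly_Mapping.single V4 d"

definition binomial :: "mon \<Rightarrow> mon \<Rightarrow> 'a::comm_ring_1 mpoly4" where
  "binomial a b = Poly_Mapping.single a 1 - Poly_Mapping.single b 1"

lemma lookup_mon4 [simp]: "Poly_Mapping.lookup (mon4 a b c d) v = tuple a b c d v"
  by (cases v) (simp_all add: mon4_def lookup_add lookup_single)

lemma sum_var: "(\<Sum>v\<in>UNIV. h v) = h V1 + h V2 + h V3 + h V4"
  by (simp add: UNIV_var add.assoc)

lemma weight_mon4: "weight n (mon4 a b c d) = a * n V1 + b * n V2 + c * n V3 + d * n V4"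
  by (simp add: weight_def sum_var)

lemma tdeg_mon4: "tdeg (mon4 a b c d) = a + b + c + d"
  by (simp add: tdeg_def sum_var)

lemma mon_dvd_mon4:
  assumes "a \<le> Poly_Mapping.lookup m V1" "b \<le> Poly_Mapping.lookup m V2"
    "c \<le> Poly_Mapping.lookup m V3" "d \<le> Poly_Mapping.lookup m V4"
  shows "mon_dvd (mon4 a b c d) m"
  unfolding mon_dvd_def
proof
  show "m = mon4 a b c d + (m - mon4 a b c d)"
  proof (rule poly_mapping_eqI)
    fix v show "Poly_Mapping.lookup m v = Poly_Mapping.lookup (mon4 a b c d + (m - mon4 a b c d)) v"
      using assms by (cases v) (simp_all add: lookup_add lookup_minus)
  qed
qed

lemma X_power: "X v ^ k = (Poly_Mapping.single (Poly_Mapping.single v k) 1 :: 'a::comm_ring_1 mpoly4)"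
  by (induction k) (simp_all add: X_def mult_single single_add[symmetric])

lemma keys_binomial:
  assumes "a \<noteq> b"
  shows "Poly_Mapping.keys (binomial a b :: 'a::comm_ring_1 mpoly4) = {a, b}"
  using assms by (auto simp: binomial_def in_keys_iff lookup_minus lookup_single when_def split: if_splits)

lemma binomial_nonzero: "a \<noteq> b \<Longrightarrow> (binomial a b :: 'a::comm_ring_1 mpoly4) \<noteq> 0"
  using keys_binomial[of a b, where 'a = 'a] by auto

lemma LM_binomial_of_tdeg:
  assumes lt: "local_degree_ordering lt" and d: "tdeg a < tdeg b"
  shows "LM lt (binomial a b :: 'a::comm_ring_1 mpoly4) = a"
    and "LM lt (binomial b a :: 'a mpoly4) = a"
proof -
  have ab: "a \<noteq> b" "lt b a" using assms by (auto simp: local_degree_ordering_def)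
  show "LM lt (binomial a b :: 'a mpoly4) = a" "LM lt (binomial b a :: 'a mpoly4) = a"
    using lt ab by (auto intro!: LM_eqI simp: keys_binomial local_degree_ordering_def)
qed

lemma binomial_in_toric_ideal:
  assumes "weight n a = weight n b"
  shows "(binomial a b :: 'a::comm_ring_1 mpoly4) \<in> toric_ideal n"
proof (cases "a = b")
  case True
  then show ?thesis by (simp add: binomial_def toric_ideal_def subst_hom_def)
next
  case False
  have "subst_hom (\<lambda>v. [:0, 1:] ^ n v) (binomial a b :: 'a mpoly4) = 0"
    by (rule poly_eqI, simp only: coeff_subst_hom keys_binomial[OF False])
      (use False assms in \<open>simp add: binomial_def lookup_minus lookup_single when_def\<close>)
  then show ?thesis by (simp add: toric_ideal_def)
qed

lemma f1_binomial:
  "f1 a1 a2 a3 a4 a21 j = binomial (mon4 (a1 + j * a21) 0 0 0) (mon4 0 (j * a2) 1 (a4 - (j + 1)))"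
  by (simp add: f1_def binomial_def mon4_def X_power mult_single X_power[of V3 1, simplified])

lemma f2_binomial: "f2 a1 a2 a3 a4 a21 = binomial (mon4 0 a2 0 0) (mon4 a21 0 0 1)"
  by (simp add: f2_def binomial_def mon4_def X_power mult_single X_power[of V4 1, simplified])

lemma f3_binomial: "f3 a1 a2 a3 a4 a21 = binomial (mon4 0 0 a3 0) (mon4 (a1 - a21 - 1) 1 0 0)"
  by (simp add: f3_def binomial_def mon4_def X_power mult_single X_power[of V2 1, simplified])

lemma f4_binomial: "f4 a1 a2 a3 a4 a21 = binomial (mon4 0 0 0 a4) (mon4 1 (a2 - 1) (a3 - 1) 0)"
  by (simp add: f4_def binomial_def mon4_def X_power mult_single X_power[of V1 1, simplified])

lemma g_binomial:
  "g a1 a2 a3 a4 a21 j i =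
     binomial (mon4 0 (((a4 - 1) * i + j) * a2 + 1) 0 (a4 - (j + 1)))
       (mon4 (g_exp1 a1 a2 a3 a4 a21 j i) 0 (a3 - (i + 1)) 0)"
  unfolding g_def binomial_def mon4_def X_power mult_single by simp

section \<open>The lattice of relations between the generators\<close>

locale komeda_semigroup =
  fixes n :: "var \<Rightarrow> nat" and a1 a2 a3 a4 a21 :: nat
  assumes order: "0 < n V1" "n V1 < n V2" "n V2 < n V3" "n V3 < n V4"
    and gcd: "Gcd {n V1, n V2, n V3, n V4} = 1"
    and komeda: "komeda_parameters n a1 a2 a3 a4 a21"
    and a2_gt: "a21 + 1 < a2"
begin

lemma bounds: "1 < a1" "1 < a2" "1 < a3" "1 < a4" "0 < a21" "a21 + 1 < a1"
  using komeda by (auto simp: komeda_parameters_def less_diff_conv)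

lemma generator_relations:
  shows rel1: "a1 * n V1 = n V3 + (a4 - 1) * n V4"
    and rel2: "a2 * n V2 = a21 * n V1 + n V4"
    and rel3: "a3 * n V3 = (a1 - a21 - 1) * n V1 + n V2"
proof -
  obtain c where c: "a1 = c + a21 + 1"
    using bounds by (metis Suc_eq_plus1 add.commute add_Suc_right less_imp_Suc_add)
  obtain k2 k3 k4 where k: "a2 = k2 + 1" "a3 = k3 + 1" "a4 = k4 + 1"
    using bounds by (metis Suc_eq_plus1 less_imp_Suc_add)
  have n: "n V1 = a2 * a3 * k4 + 1" "n V2 = a21 * a3 * a4 + c * k3 + a3"
    "n V3 + a4 = a1 * a4 + c * k2 * k4 + 1"
    "n V4 = a1 * a2 * k3 + a21 * k2 + a2"
    using komeda c k by (auto simp: komeda_parameters_def)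
  have n3: "n V3 = (c + a21) * a4 + c * k2 * k4 + 1" using n(3) c by (simp add: algebra_simps)
  show "a1 * n V1 = n V3 + (a4 - 1) * n V4" "a2 * n V2 = a21 * n V1 + n V4"
    "a3 * n V3 = (a1 - a21 - 1) * n V1 + n V2"
    unfolding n(1,2,4) n3 unfolding c k by (simp_all add: algebra_simps)
qed

lemma relations_int:
  shows "int a1 * int (n V1) = int (n V3) + (int a4 - 1) * int (n V4)"
    and "int a2 * int (n V2) = int a21 * int (n V1) + int (n V4)"
    and "int a3 * int (n V3) = (int a1 - int a21 - 1) * int (n V1) + int (n V2)"
    and "int (n V1) = int a2 * int a3 * (int a4 - 1) + 1"
  using generator_relations[THEN arg_cong, of int] bounds komeda
  by (auto simp: of_nat_diff komeda_parameters_def)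

text \<open>Modulo \<open>n\<^sub>1\<close> the other generators are multiples of \<open>n\<^sub>3\<close>.\<close>

lemma coprime_n1_n3: "coprime (int (n V1)) (int (n V3))"
proof -
  define d where "d = gcd (n V1) (n V3)"
  have d: "d dvd n V1" "d dvd n V3" by (auto simp: d_def)
  then have "d dvd a3 * n V3" "d dvd (a1 - a21 - 1) * n V1" by auto
  then have d2: "d dvd n V2" using rel3 by (metis dvd_add_right_iff)
  then have "d dvd a2 * n V2" "d dvd a21 * n V1" using d by auto
  then have "d dvd n V4" using rel2 by (metis dvd_add_right_iff)
  with d d2 have "d dvd Gcd {n V1, n V2, n V3, n V4}" by (intro Gcd_greatest) auto
  then have "d dvd 1" unfolding gcd .
  then have "d = 1" by simp
  then show ?thesis unfolding d_def coprime_iff_gcd_eq_1 by (simp add: gcd_int_int_eq)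
qed

lemma relation_lattice:
  fixes x1 x2 x3 x4 :: int
  assumes "x1 * n V1 + x2 * n V2 + x3 * n V3 + x4 * n V4 = 0"
  obtains p q r :: int where
    "x1 = a1 * p - a21 * q - (int a1 - a21 - 1) * r"
    "x2 = a2 * q - r" "x3 = a3 * r - p" "x4 = - (int a4 - 1) * p - q"
proof -
  define n1 where "n1 = int (n V1)"
  define c h where "c = int a1 - a21 - 1" and "h = int a4 - 1"
  note R = relations_int[folded n1_def c_def h_def]
  have n2: "int (n V2) = a3 * n V3 - c * n1" using R(3) by simp
  have n4: "int (n V4) = a2 * (a3 * n V3 - c * n1) - a21 * n1" using R(2) by (simp add: n2)
  have "x1 * n1 + x2 * (a3 * n V3 - c * n1) + x3 * n V3
      + x4 * (a2 * (a3 * n V3 - c * n1) - a21 * n1) = 0"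
    using assms unfolding n1_def[symmetric] n2 n4 .
  then have "n V3 * (a3 * x2 + x3 + a2 * a3 * x4) = n1 * (c * x2 + (a2 * c + a21) * x4 - x1)"
    by (simp add: algebra_simps)
  then have "n1 dvd n V3 * (a3 * x2 + x3 + a2 * a3 * x4)" by simp
  then have "n1 dvd a3 * x2 + x3 + a2 * a3 * x4"
    using coprime_n1_n3 unfolding n1_def by (simp add: coprime_dvd_mult_right_iff)
  then obtain k where k: "a3 * x2 + x3 + a2 * a3 * x4 = n1 * k" by (auto simp: dvd_def)
  \<comment> \<open>Multiplication by \<open>a2 * h\<close>, the inverse of \<open>-a3\<close> modulo \<open>n\<^sub>1\<close>, solves for \<open>r\<close>.\<close>
  define r where "r = a2 * h * k - x2 - a2 * x4"
  define p where "p = a3 * r - x3"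
  define q where "q = - h * p - x4"
  have "n1 * r = a2 * h * (n1 * k) - n1 * (x2 + a2 * x4)"
    by (simp add: r_def algebra_simps)
  also have "\<dots> = a2 * h * x3 - x2 - a2 * x4"
    unfolding k[symmetric] unfolding R(4) by (simp add: algebra_simps)
  finally have "n1 * r = a2 * h * x3 - x2 - a2 * x4" .
  then have x2: "x2 = a2 * q - r"
    unfolding q_def p_def R(4) by (simp add: algebra_simps)
  have x3: "x3 = a3 * r - p" and x4: "x4 = - h * p - q"
    by (auto simp: p_def q_def)
  have "n1 * (a1 * p - a21 * q - c * r) = p * (a1 * n1) - q * (a21 * n1) - r * (c * n1)"
    by (simp add: algebra_simps)
  also have "\<dots> = p * (n V3 + h * n V4) - q * (int a2 * n V2 - int (n V4)) - r * (int a3 * n V3 - int (n V2))"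
    using R(1-3) by simp
  also have "\<dots> = - (x2 * n V2 + x3 * n V3 + x4 * n V4)"
    unfolding x2 x3 x4 by (simp add: algebra_simps)
  also have "\<dots> = n1 * x1"
    using assms by (simp add: n1_def algebra_simps)
  finally have "x1 = a1 * p - a21 * q - c * r" using order by (simp add: n1_def)
  then show thesis using that x2 x3 x4 by (simp add: c_def h_def)
qed

text \<open>
  Neither monomial is divisible by \<open>LM f\<^sub>3\<close> or \<open>LM f\<^sub>4\<close>, and \<open>x\<close> is not divisible by \<open>LM f\<^sub>2\<close>.
  The bounds on \<open>X\<^sub>3\<close> and \<open>X\<^sub>4\<close> confine \<open>r\<close> and \<open>q\<close> once \<open>p\<close> is given; this makes the
  \<open>X\<^sub>1\<close>-exponent of \<open>x\<close> so large that \<open>X\<^sub>4\<close> cannot occur in \<open>x\<close>, and \<open>j\<close> is read off from the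
  \<open>X\<^sub>4\<close>-exponent of \<open>y\<close>. If \<open>X\<^sub>3\<close> does not occur in \<open>y\<close>, then \<open>i\<close> is read off from the
  \<open>X\<^sub>3\<close>-exponent of \<open>x\<close>. The binomial is \<open>g\<^bsub>j,i\<^esub>\<close> itself for \<open>r = 1\<close>, and
  raising \<open>r\<close> only increases the exponents of \<open>X\<^sub>1\<close> and \<open>X\<^sub>2\<close>.
\<close>

lemma positive_case:
  fixes x y :: "var \<Rightarrow> nat" and p q r :: int
  assumes p: "1 \<le> p"
    and d1: "int (x V1) - y V1 = a1 * p - a21 * q - (int a1 - a21 - 1) * r"
    and d2: "int (x V2) - y V2 = a2 * q - r"
    and d3: "int (x V3) - y V3 = a3 * r - p"
    and d4: "int (x V4) - y V4 = - (int a4 - 1) * p - q"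
    and x3: "x V3 < a3" and y3: "y V3 < a3" and x4: "x V4 < a4" and y4: "y V4 < a4"
    and no_f2: "\<not> (a21 \<le> x V1 \<and> 1 \<le> x V4)"
  obtains (f1) j where "j \<le> a4 - 1" "j * a2 \<le> y V2" "1 \<le> y V3" "a4 - (j + 1) \<le> y V4"
  | (g) j i where "j \<le> a4 - 1"
      "((a4 - 1) * i + j) * a2 + 1 \<le> y V2" "a4 - (j + 1) \<le> y V4"
      "g_exp1 a1 a2 a3 a4 a21 j i \<le> x V1" "a3 - (i + 1) \<le> x V3"
proof -
  define c where "c = int a1 - a21 - 1"
  have c: "0 < c" "int a1 = c + a21 + 1" using bounds by (auto simp: c_def)
  define Q where "Q = - q"
  have Q: "Q = (int a4 - 1) * p + (int (x V4) - y V4)" using d4 by (simp add: Q_def algebra_simps)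
  have r0: "0 \<le> r"
  proof (rule ccontr)
    assume "\<not> 0 \<le> r"
    then have "int a3 * r \<le> int a3 * (-1)" by (intro mult_left_mono) auto
    then show False using d3 y3 p by linarith
  qed
  have rp: "r \<le> p"
  proof (rule ccontr)
    assume "\<not> r \<le> p"
    then have "int a3 * (p + 1) \<le> int a3 * r" by (intro mult_left_mono) auto
    moreover have "1 * p \<le> int a3 * p" using bounds p by (intro mult_right_mono) auto
    ultimately show False using d3 x3 by (simp add: algebra_simps)
  qed
  have Qge: "(int a4 - 1) * (p - 1) \<le> Q" using Q y4 by (simp add: algebra_simps)
  have Q0: "0 \<le> Q" using Qge p bounds by (smt (verit) mult_nonneg_nonneg of_nat_1 of_nat_less_iff)
  have D1: "int (x V1) - y V1 = a1 * p + a21 * Q - c * r" using d1 by (simp add: Q_def c_def)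
  have "int a21 \<le> x V1"
  proof -
    define u v w where "u = c * (p - r)" and "v = (int a21 + 1) * p" and "w = a21 * Q"
    have "0 \<le> u" using c rp by (simp add: u_def)
    moreover have "0 \<le> w" using Q0 by (simp add: w_def)
    moreover
    have "(int a21 + 1) * 1 \<le> v" unfolding v_def using p by (intro mult_left_mono) auto
    then have "int a21 + 1 \<le> v" by simp
    moreover have "int (x V1) - y V1 = u + v + w"
      unfolding D1 u_def v_def w_def c(2) by (simp add: algebra_simps)
    ultimately show ?thesis by linarith
  qed
  then have x4_0: "x V4 = 0" using no_f2 by simp
  define j where "j = a4 - 1 - y V4"
  have j: "int j = int a4 - 1 - y V4" "j \<le> a4 - 1" "a4 - (j + 1) \<le> y V4"
    using y4 by (auto simp: j_def)
  have Qj: "Q = (int a4 - 1) * (p - 1) + j" using Q x4_0 j(1) by (simp add: algebra_simps)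
  have y2: "a2 * Q + r \<le> int (y V2)" using d2 by (simp add: Q_def)
  show thesis
  proof (cases "y V3 = 0")
    case False
    have "0 \<le> (int a4 - 1) * (p - 1)" using p bounds by simp
    then have "int a2 * int j \<le> int a2 * Q" using Qj by (intro mult_left_mono) auto
    then have "int (j * a2) \<le> int (y V2)" using y2 r0 by (simp add: mult.commute)
    then have "j * a2 \<le> y V2" by (simp only: of_nat_le_iff)
    then show thesis using f1 j False by simp
  next
    case True
    define i where "i = a3 - 1 - x V3"
    have i: "int i = int a3 - 1 - x V3" "a3 - (i + 1) \<le> x V3" using x3 by (auto simp: i_def)
    have pi: "p = i + 1 + a3 * (r - 1)" using d3 True i(1) by (simp add: algebra_simps)
    have r1: "1 \<le> r"
    proof (rule ccontr)
      assume "\<not> 1 \<le> r"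
      then have "r = 0" using r0 by simp
      then show False using pi p i(1) by simp
    qed
    have "0 \<le> int a3 * (r - 1)" using r1 by simp
    then have ip: "int i \<le> p - 1" using pi by simp
    then have "(int a4 - 1) * i \<le> (int a4 - 1) * (p - 1)" using bounds by (intro mult_left_mono) auto
    then have Qi: "(int a4 - 1) * i + j \<le> Q" using Qj by simp
    then have "int a2 * ((int a4 - 1) * i + j) \<le> int a2 * Q" by (intro mult_left_mono) auto
    then have "int a2 * ((int a4 - 1) * i + j) + 1 \<le> int (y V2)" using y2 r1 by linarith
    moreover have "int (((a4 - 1) * i + j) * a2 + 1) = int a2 * ((int a4 - 1) * i + j) + 1"
      using bounds by (simp add: of_nat_diff)
    ultimately have "int (((a4 - 1) * i + j) * a2 + 1) \<le> int (y V2)" by (simp only:)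
    then have Y2: "((a4 - 1) * i + j) * a2 + 1 \<le> y V2" by (simp only: of_nat_le_iff)
    have "c \<le> int a1 * a3"
    proof -
      have "c * 1 \<le> int a1 * a3" using c bounds by (intro mult_mono) auto
      then show ?thesis by simp
    qed
    then have "c * (r - 1) \<le> int a1 * a3 * (r - 1)" using r1 by (intro mult_right_mono) auto
    then have "int a1 * (i + 1) - c \<le> a1 * p - c * r" unfolding pi by (simp add: algebra_simps)
    moreover have "int a21 * ((int a4 - 1) * i + j) \<le> a21 * Q" using Qi by (intro mult_left_mono) auto
    ultimately have "int a1 * (i + 1) - c + int a21 * ((int a4 - 1) * i + j) \<le> x V1"
      using D1 by linarith
    moreover have "int (g_exp1 a1 a2 a3 a4 a21 j i)
        = int a1 * (i + 1) - c + int a21 * ((int a4 - 1) * i + j)"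
      using bounds by (simp add: g_exp1_def of_nat_diff c_def) (simp add: algebra_simps)
    ultimately have "int (g_exp1 a1 a2 a3 a4 a21 j i) \<le> int (x V1)" by simp
    then have "g_exp1 a1 a2 a3 a4 a21 j i \<le> x V1" by (simp only: of_nat_le_iff)
    then show thesis using g j Y2 i by blast
  qed
qed

section \<open>Weights and degrees of the proposed basis\<close>

lemma weight_f1:
  assumes "j \<le> a4 - 1"
  shows "weight n (mon4 (a1 + j * a21) 0 0 0) = weight n (mon4 0 (j * a2) 1 (a4 - (j + 1)))"
proof -
  have "int (weight n (mon4 (a1 + j * a21) 0 0 0))
      = int (weight n (mon4 0 (j * a2) 1 (a4 - (j + 1))))"
    using relations_int assms bounds by (simp add: weight_mon4 of_nat_diff) algebra
  then show ?thesis by (simp only: of_nat_eq_iff)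
qed

lemma weight_f2: "weight n (mon4 0 a2 0 0) = weight n (mon4 a21 0 0 1)"
  using rel2 by (simp add: weight_mon4)

lemma weight_f3: "weight n (mon4 0 0 a3 0) = weight n (mon4 (a1 - a21 - 1) 1 0 0)"
  using rel3 by (simp add: weight_mon4)

lemma weight_f4: "weight n (mon4 0 0 0 a4) = weight n (mon4 1 (a2 - 1) (a3 - 1) 0)"
proof -
  have "int (weight n (mon4 0 0 0 a4)) = int (weight n (mon4 1 (a2 - 1) (a3 - 1) 0))"
    using relations_int bounds by (simp add: weight_mon4 of_nat_diff) algebra
  then show ?thesis by (simp only: of_nat_eq_iff)
qed

lemma weight_g:
  assumes "j \<le> a4 - 1" "i < a3"
  shows "weight n (mon4 0 (((a4 - 1) * i + j) * a2 + 1) 0 (a4 - (j + 1)))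
    = weight n (mon4 (g_exp1 a1 a2 a3 a4 a21 j i) 0 (a3 - (i + 1)) 0)"
proof -
  have "int (weight n (mon4 0 (((a4 - 1) * i + j) * a2 + 1) 0 (a4 - (j + 1))))
    = int (weight n (mon4 (g_exp1 a1 a2 a3 a4 a21 j i) 0 (a3 - (i + 1)) 0))"
    using relations_int assms bounds by (simp add: weight_mon4 of_nat_diff g_exp1_def) algebra
  then show ?thesis by (simp only: of_nat_eq_iff)
qed

text \<open>
  Between two monomials of equal weight, the one in heavier variables has the smaller degree.
  The threshold \<open>k\<close> is the weight of a variable separating the two sets of variables.
\<close>

lemma tdeg_less_of_weight:
  assumes w: "weight n a = weight n b" and "0 < k"
    and a: "\<And>v. Poly_Mapping.lookup a v \<noteq> 0 \<Longrightarrow> k \<le> n v"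
    and b: "\<And>v. Poly_Mapping.lookup b v \<noteq> 0 \<Longrightarrow> n v \<le> k"
    and strict: "Poly_Mapping.lookup a u * k < Poly_Mapping.lookup a u * n u
      \<or> Poly_Mapping.lookup b u * n u < Poly_Mapping.lookup b u * k"
  shows "tdeg a < tdeg b"
proof -
  have le_a: "Poly_Mapping.lookup a v * k \<le> Poly_Mapping.lookup a v * n v" for v
    using a[of v] by (cases "Poly_Mapping.lookup a v = 0") auto
  have le_b: "Poly_Mapping.lookup b v * n v \<le> Poly_Mapping.lookup b v * k" for v
    using b[of v] by (cases "Poly_Mapping.lookup b v = 0") auto
  have A: "tdeg a * k \<le> weight n a" and B: "weight n b \<le> tdeg b * k"
    unfolding tdeg_def weight_def sum_distrib_right using le_a le_b by (auto intro!: sum_mono)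
  have "tdeg a * k < weight n a \<or> weight n b < tdeg b * k"
    using strict
  proof
    assume "Poly_Mapping.lookup a u * k < Poly_Mapping.lookup a u * n u"
    then have "tdeg a * k < weight n a"
      unfolding tdeg_def weight_def sum_distrib_right using le_a by (intro sum_strict_mono_ex1) auto
    then show ?thesis ..
  next
    assume "Poly_Mapping.lookup b u * n u < Poly_Mapping.lookup b u * k"
    then have "weight n b < tdeg b * k"
      unfolding tdeg_def weight_def sum_distrib_right using le_b by (intro sum_strict_mono_ex1) auto
    then show ?thesis ..
  qed
  then have "tdeg a * k < tdeg b * k" using A B w by linarith
  then show ?thesis by simp
qed

lemma n_mono: "n V1 \<le> n v" "n v \<le> n V4"
  using order by (cases v; simp)+

lemma tdeg_f1:
  assumes "j \<le> a4 - 1"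
  shows "tdeg (mon4 0 (j * a2) 1 (a4 - (j + 1))) < tdeg (mon4 (a1 + j * a21) 0 0 0)"
proof (rule tdeg_less_of_weight[where k = "n V1" and u = V3])
  show "n v \<le> n V1" if "Poly_Mapping.lookup (mon4 (a1 + j * a21) 0 0 0) v \<noteq> 0" for v
    using that by (cases v) auto
qed (use weight_f1[OF assms] order n_mono in auto)

lemma tdeg_f2: "tdeg (mon4 a21 0 0 1) < tdeg (mon4 0 a2 0 0)"
  using a2_gt by (simp add: tdeg_mon4)

lemma tdeg_f3: "tdeg (mon4 0 0 a3 0) < tdeg (mon4 (a1 - a21 - 1) 1 0 0)"
proof (rule tdeg_less_of_weight[where k = "n V2" and u = V3])
  show "n V2 \<le> n v" if "Poly_Mapping.lookup (mon4 0 0 a3 0) v \<noteq> 0" for v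
    using that order by (cases v) auto
  show "n v \<le> n V2" if "Poly_Mapping.lookup (mon4 (a1 - a21 - 1) 1 0 0) v \<noteq> 0" for v
    using that order by (cases v) auto
qed (use weight_f3 order bounds in auto)

lemma tdeg_f4: "tdeg (mon4 0 0 0 a4) < tdeg (mon4 1 (a2 - 1) (a3 - 1) 0)"
proof (rule tdeg_less_of_weight[where k = "n V4" and u = V1])
  show "n V4 \<le> n v" if "Poly_Mapping.lookup (mon4 0 0 0 a4) v \<noteq> 0" for v
    using that by (cases v) auto
qed (use weight_f4 order n_mono in auto)

abbreviation s_cond :: "nat \<Rightarrow> nat \<Rightarrow> bool" where
  "s_cond j s \<equiv> ((int a4 - 1) * int s + int j) * int a2 + int a4 - int j
     < int s * int a1 + ((int a4 - 1) * int s + int j + 1) * int a21 + int a3 - int s"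

lemma s_cond_iff_tdeg:
  assumes "j \<le> a4 - 1" "s < a3"
  shows "s_cond j s \<longleftrightarrow> tdeg (mon4 0 (((a4 - 1) * s + j) * a2 + 1) 0 (a4 - (j + 1)))
    < tdeg (mon4 (g_exp1 a1 a2 a3 a4 a21 j s) 0 (a3 - (s + 1)) 0)"
    (is "_ \<longleftrightarrow> ?d1 < ?d2")
proof -
  have "int ?d1 = ((int a4 - 1) * int s + int j) * int a2 + int a4 - int j"
    "int ?d2 = int s * int a1 + ((int a4 - 1) * int s + int j + 1) * int a21 + int a3 - int s"
    using assms bounds by (simp_all add: tdeg_mon4 of_nat_diff g_exp1_def) (simp add: algebra_simps)
  then show ?thesis by linarith
qed

text \<open>The second monomial of \<open>g\<^bsub>j,\<alpha>\<^sub>3-1\<^esub>\<close> is a power of \<open>X\<^sub>1\<close>, the lightest variable.\<close>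

lemma s_cond_top:
  assumes "j \<le> a4 - 1"
  shows "s_cond j (a3 - 1)"
proof -
  have i: "a3 - 1 < a3" using bounds by simp
  let ?e = "Poly_Mapping.lookup (mon4 0 (((a4 - 1) * (a3 - 1) + j) * a2 + 1) 0 (a4 - (j + 1))) V2"
  have strict: "?e * n V1 < ?e * n V2" using order by (intro mult_strict_left_mono) auto
  show ?thesis
    unfolding s_cond_iff_tdeg[OF assms i]
  proof (rule tdeg_less_of_weight[where k = "n V1" and u = V2])
    show "n v \<le> n V1"
      if "Poly_Mapping.lookup (mon4 (g_exp1 a1 a2 a3 a4 a21 j (a3 - 1)) 0 (a3 - (a3 - 1 + 1)) 0) v \<noteq> 0" for v
      using that by (cases v) auto
  qed (use strict weight_g[OF assms i] order n_mono in auto)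
qed

lemma s_num_props:
  assumes "j \<le> a4 - 1"
  shows s_cond_s_num: "s_cond j (s_num a1 a2 a3 a4 a21 j)"
    and s_num_less: "s_num a1 a2 a3 a4 a21 j < a3"
proof -
  show "s_cond j (s_num a1 a2 a3 a4 a21 j)"
    unfolding s_num_def by (rule LeastI) (rule s_cond_top[OF assms])
  have "s_num a1 a2 a3 a4 a21 j \<le> a3 - 1"
    unfolding s_num_def by (rule Least_le) (rule s_cond_top[OF assms])
  then show "s_num a1 a2 a3 a4 a21 j < a3" using bounds by simp
qed

text \<open>
  Passing from \<open>j\<close> to \<open>j - 1\<close> lowers the left-hand side of the defining inequality by \<open>\<alpha>\<^sub>2 - 1\<close> and
  the right-hand side only by \<open>\<alpha>\<^sub>2\<^sub>1 < \<alpha>\<^sub>2 - 1\<close>. Hence the range of \<open>i\<close> contains \<open>s\<^sub>j\<close>.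
\<close>

lemma s_prev_le:
  assumes "j \<le> a4 - 1"
  shows "s_prev a1 a2 a3 a4 a21 j \<le> s_num a1 a2 a3 a4 a21 j"
proof (cases j)
  case (Suc k)
  let ?s = "s_num a1 a2 a3 a4 a21 j"
  have "s_cond k ?s"
    using s_cond_s_num[OF assms] a2_gt unfolding Suc by (simp add: algebra_simps)
  then have "s_num a1 a2 a3 a4 a21 k \<le> ?s"
    unfolding s_num_def[of _ _ _ _ _ k] by (rule Least_le)
  then show ?thesis by (simp add: s_prev_def Suc)
qed (simp add: s_prev_def)

section \<open>The standard basis\<close>

lemma finite_G_set: "finite (G_set a1 a2 a3 a4 a21)"
proof -
  have "{f1 a1 a2 a3 a4 a21 j | j. j \<le> a4 - 1} = f1 a1 a2 a3 a4 a21 ` {..a4 - 1}"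
    by auto
  moreover have "{g a1 a2 a3 a4 a21 j i | j i. j \<le> a4 - 1 \<and>
      s_prev a1 a2 a3 a4 a21 j \<le> i \<and> i \<le> s_num a1 a2 a3 a4 a21 j}
    \<subseteq> (\<Union>j\<in>{..a4 - 1}. g a1 a2 a3 a4 a21 j ` {..s_num a1 a2 a3 a4 a21 j})"
    by auto
  then have "finite {g a1 a2 a3 a4 a21 j i | j i. j \<le> a4 - 1 \<and>
      s_prev a1 a2 a3 a4 a21 j \<le> i \<and> i \<le> s_num a1 a2 a3 a4 a21 j}"
    by (rule finite_subset) auto
  ultimately show ?thesis unfolding G_set_def by simp
qed

lemma G_set_toric: "G_set a1 a2 a3 a4 a21 \<subseteq> (toric_ideal n :: 'a::comm_ring_1 mpoly4 set)"
proof -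
  have "g a1 a2 a3 a4 a21 j i \<in> (toric_ideal n :: 'a mpoly4 set)"
    if "j \<le> a4 - 1" "i \<le> s_num a1 a2 a3 a4 a21 j" for j i
    using weight_g[OF that(1)] s_num_less[OF that(1)] that(2)
    by (simp only: g_binomial) (intro binomial_in_toric_ideal, simp)
  then show ?thesis
    unfolding G_set_def
    using weight_f1 weight_f2 weight_f3 weight_f4
    by (auto simp: f1_binomial f2_binomial f3_binomial f4_binomial intro!: binomial_in_toric_ideal)
qed

text \<open>
  Everywhere except in \<open>g\<^bsub>j,i\<^esub>\<close> with \<open>i < s\<^sub>j\<close> the degrees of the two monomials differ strictly and
  decide; for \<open>i < s\<^sub>j\<close> they may agree, and \<open>ties\<close> selects the \<open>X\<^sub>1,X\<^sub>3\<close>-monomial.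
\<close>

lemma leading_monomials:
  fixes lt :: "mon \<Rightarrow> mon \<Rightarrow> bool"
  assumes lt: "local_degree_ordering lt"
    and ties: "\<forall>j i. j \<le> a4 - 1 \<longrightarrow> i < s_num a1 a2 a3 a4 a21 j \<longrightarrow>
           LM lt (g a1 a2 a3 a4 a21 j i :: 'a::comm_ring_1 mpoly4)
           = mon4 (g_exp1 a1 a2 a3 a4 a21 j i) 0 (a3 - (i + 1)) 0"
  defines "leads \<equiv> LM lt ` (G_set a1 a2 a3 a4 a21 - {0 :: 'a mpoly4})"
  shows "mon4 a21 0 0 1 \<in> leads" "mon4 0 0 a3 0 \<in> leads" "mon4 0 0 0 a4 \<in> leads"
    and "\<And>j. j \<le> a4 - 1 \<Longrightarrow> mon4 0 (j * a2) 1 (a4 - (j + 1)) \<in> leads"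
    and "\<And>j. j \<le> a4 - 1 \<Longrightarrow>
      mon4 0 (((a4 - 1) * s_num a1 a2 a3 a4 a21 j + j) * a2 + 1) 0 (a4 - (j + 1)) \<in> leads"
    and "\<And>j i. j \<le> a4 - 1 \<Longrightarrow> s_prev a1 a2 a3 a4 a21 j \<le> i \<Longrightarrow> i < s_num a1 a2 a3 a4 a21 j \<Longrightarrow>
      mon4 (g_exp1 a1 a2 a3 a4 a21 j i) 0 (a3 - (i + 1)) 0 \<in> leads"
proof -
  have first: "a \<in> leads"
    if "(binomial a b :: 'a mpoly4) \<in> G_set a1 a2 a3 a4 a21" "tdeg a < tdeg b" for a b
  proof -
    have "a \<noteq> b" using that by auto
    then show ?thesis unfolding leads_def
      using LM_binomial_of_tdeg(1)[OF lt that(2), where 'a = 'a] binomial_nonzero that(1)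
      by (intro image_eqI[of _ _ "binomial a b"]) auto
  qed
  have second: "a \<in> leads"
    if "(binomial b a :: 'a mpoly4) \<in> G_set a1 a2 a3 a4 a21" "tdeg a < tdeg b" for a b
  proof -
    have "b \<noteq> a" using that by auto
    then show ?thesis unfolding leads_def
      using LM_binomial_of_tdeg(2)[OF lt that(2), where 'a = 'a] binomial_nonzero that(1)
      by (intro image_eqI[of _ _ "binomial b a"]) auto
  qed
  show "mon4 a21 0 0 1 \<in> leads"
    by (rule second[OF _ tdeg_f2]) (simp add: G_set_def f2_binomial)
  show "mon4 0 0 a3 0 \<in> leads"
    by (rule first[OF _ tdeg_f3]) (simp add: G_set_def f3_binomial)
  show "mon4 0 0 0 a4 \<in> leads"
    by (rule first[OF _ tdeg_f4]) (simp add: G_set_def f4_binomial)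
  show "mon4 0 (j * a2) 1 (a4 - (j + 1)) \<in> leads" if "j \<le> a4 - 1" for j
    by (rule second[OF _ tdeg_f1[OF that]])
      (use that in \<open>auto simp only: G_set_def f1_binomial\<close>)
  show "mon4 0 (((a4 - 1) * s_num a1 a2 a3 a4 a21 j + j) * a2 + 1) 0 (a4 - (j + 1)) \<in> leads"
    if "j \<le> a4 - 1" for j
  proof (rule first)
    show "tdeg (mon4 0 (((a4 - 1) * s_num a1 a2 a3 a4 a21 j + j) * a2 + 1) 0 (a4 - (j + 1)))
      < tdeg (mon4 (g_exp1 a1 a2 a3 a4 a21 j (s_num a1 a2 a3 a4 a21 j)) 0
          (a3 - (s_num a1 a2 a3 a4 a21 j + 1)) 0)"
      using s_cond_s_num[OF that] s_cond_iff_tdeg[OF that s_num_less[OF that]] by blast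
  qed (unfold g_binomial[symmetric] G_set_def, use that s_prev_le[OF that] in blast)
  show "mon4 (g_exp1 a1 a2 a3 a4 a21 j i) 0 (a3 - (i + 1)) 0 \<in> leads"
    if "j \<le> a4 - 1" "s_prev a1 a2 a3 a4 a21 j \<le> i" "i < s_num a1 a2 a3 a4 a21 j" for j i
  proof -
    have "mon4 0 (((a4 - 1) * i + j) * a2 + 1) 0 (a4 - (j + 1))
        \<noteq> mon4 (g_exp1 a1 a2 a3 a4 a21 j i) 0 (a3 - (i + 1)) 0" (is "?a \<noteq> ?b")
    proof
      assume "?a = ?b"
      then have "Poly_Mapping.lookup ?a V2 = Poly_Mapping.lookup ?b V2" by (rule arg_cong)
      then show False by simp
    qed
    then have "g a1 a2 a3 a4 a21 j i \<noteq> (0 :: 'a mpoly4)"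
      unfolding g_binomial by (rule binomial_nonzero)
    moreover have "g a1 a2 a3 a4 a21 j i \<in> (G_set a1 a2 a3 a4 a21 :: 'a mpoly4 set)"
      unfolding G_set_def using that less_imp_le[OF that(3)] by blast
    ultimately show ?thesis unfolding leads_def
      using ties[rule_format, OF that(1,3)] by (intro image_eqI[of _ _ "g a1 a2 a3 a4 a21 j i"]) auto
  qed
qed

theorem standard_basis_G_set:
  fixes lt :: "mon \<Rightarrow> mon \<Rightarrow> bool"
  assumes lt: "local_degree_ordering lt"
    and ties: "\<forall>j i. j \<le> a4 - 1 \<longrightarrow> i < s_num a1 a2 a3 a4 a21 j \<longrightarrow>
           LM lt (g a1 a2 a3 a4 a21 j i :: 'a::comm_ring_1 mpoly4)
           = mon4 (g_exp1 a1 a2 a3 a4 a21 j i) 0 (a3 - (i + 1)) 0"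
  shows "standard_basis lt (toric_ideal n) (G_set a1 a2 a3 a4 a21 :: 'a mpoly4 set)"
proof (rule standard_basis_toricI[OF _ _ finite_G_set G_set_toric])
  show "monomial_ordering lt" using lt by (simp add: local_degree_ordering_def)
  show "0 < n v" for v using order n_mono(1)[of v] by simp
  define leads where "leads = LM lt ` (G_set a1 a2 a3 a4 a21 - {0 :: 'a mpoly4})"
  note lead = leading_monomials[OF lt ties, folded leads_def]
  define normal where "normal m \<longleftrightarrow> (\<forall>u\<in>leads. \<not> mon_dvd u m)" for m
  have normal_bounds: "Poly_Mapping.lookup m V3 < a3" "Poly_Mapping.lookup m V4 < a4"
    "\<not> (a21 \<le> Poly_Mapping.lookup m V1 \<and> 1 \<le> Poly_Mapping.lookup m V4)" if "normal m" for m
    using that lead(1-3) mon_dvd_mon4[of 0 m 0 a3 0] mon_dvd_mon4[of 0 m 0 0 a4]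
      mon_dvd_mon4[of a21 m 0 0 1] unfolding normal_def by (auto simp: not_le[symmetric])
  have no_positive: False
    if m: "normal m" "normal m'" and p: "1 \<le> p"
      and d: "int (Poly_Mapping.lookup m V1) - Poly_Mapping.lookup m' V1
          = a1 * p - a21 * q - (int a1 - a21 - 1) * r"
        "int (Poly_Mapping.lookup m V2) - Poly_Mapping.lookup m' V2 = a2 * q - r"
        "int (Poly_Mapping.lookup m V3) - Poly_Mapping.lookup m' V3 = a3 * r - p"
        "int (Poly_Mapping.lookup m V4) - Poly_Mapping.lookup m' V4 = - (int a4 - 1) * p - q"
    for m m' and p q r :: int
  proof (rule positive_case[OF p d])
    fix j assume "j \<le> a4 - 1" "j * a2 \<le> Poly_Mapping.lookup m' V2"
      "1 \<le> Poly_Mapping.lookup m' V3" "a4 - (j + 1) \<le> Poly_Mapping.lookup m' V4"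
    then have "mon_dvd (mon4 0 (j * a2) 1 (a4 - (j + 1))) m'" by (intro mon_dvd_mon4) auto
    then show False using lead(4) \<open>j \<le> a4 - 1\<close> m(2) unfolding normal_def by blast
  next
    fix j i
    assume j: "j \<le> a4 - 1"
      and y: "((a4 - 1) * i + j) * a2 + 1 \<le> Poly_Mapping.lookup m' V2"
        "a4 - (j + 1) \<le> Poly_Mapping.lookup m' V4"
      and x: "g_exp1 a1 a2 a3 a4 a21 j i \<le> Poly_Mapping.lookup m V1"
        "a3 - (i + 1) \<le> Poly_Mapping.lookup m V3"
    let ?s = "s_num a1 a2 a3 a4 a21"
    show False
    proof (cases "?s j \<le> i")
      case True
      then have le: "((a4 - 1) * ?s j + j) * a2 + 1 \<le> ((a4 - 1) * i + j) * a2 + 1"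
        by (intro add_mono mult_mono) auto
      have "mon_dvd (mon4 0 (((a4 - 1) * ?s j + j) * a2 + 1) 0 (a4 - (j + 1))) m'"
        using y(2) order_trans[OF le y(1)] by (intro mon_dvd_mon4) simp_all
      then show False using lead(5)[OF j] m(2) unfolding normal_def by blast
    next
      case False
      \<comment> \<open>Among the indices \<open>k\<close> with \<open>i < s\<^sub>k\<close> only the first satisfies \<open>s\<^bsub>k-1\<^esub> \<le> i\<close>; it also gives the
        smallest exponent of \<open>X\<^sub>1\<close>.\<close>
      define k where "k = (LEAST k. i < ?s k)"
      have k: "i < ?s k" "k \<le> j"
        using LeastI[of "\<lambda>k. i < ?s k" j] Least_le[of "\<lambda>k. i < ?s k" j] False
        unfolding k_def by simp_all
      have "s_prev a1 a2 a3 a4 a21 k \<le> i"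
        using not_less_Least[of "k - 1" "\<lambda>k. i < ?s k"] unfolding s_prev_def k_def[symmetric]
        by (auto simp: not_less)
      then have "mon4 (g_exp1 a1 a2 a3 a4 a21 k i) 0 (a3 - (i + 1)) 0 \<in> leads"
        using lead(6) k j by simp
      moreover have "g_exp1 a1 a2 a3 a4 a21 k i \<le> g_exp1 a1 a2 a3 a4 a21 j i"
        using k(2) by (simp add: g_exp1_def)
      then have "mon_dvd (mon4 (g_exp1 a1 a2 a3 a4 a21 k i) 0 (a3 - (i + 1)) 0) m"
        using x by (intro mon_dvd_mon4) auto
      ultimately show False using m(1) unfolding normal_def by blast
    qed
  qed (use normal_bounds[OF m(1)] normal_bounds[OF m(2)] in auto)
  have normal_unique: "m = m'"
    if w: "weight n m = weight n m'" and m: "normal m" "normal m'" for m m'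
  proof -
    let ?d = "\<lambda>v. int (Poly_Mapping.lookup m v) - Poly_Mapping.lookup m' v"
    have "int (weight n m) = int (weight n m')" using w by simp
    then have "?d V1 * n V1 + ?d V2 * n V2 + ?d V3 * n V3 + ?d V4 * n V4 = 0"
      by (simp add: weight_def sum_var algebra_simps)
    then obtain p q r :: int where d:
      "?d V1 = a1 * p - a21 * q - (int a1 - a21 - 1) * r"
      "?d V2 = a2 * q - r" "?d V3 = a3 * r - p" "?d V4 = - (int a4 - 1) * p - q"
      by (rule relation_lattice)
    have "\<not> 1 \<le> p" using no_positive[OF m _ d] by blast
    moreover have "\<not> 1 \<le> - p"
    proof
      have d': "int (Poly_Mapping.lookup m' V1) - Poly_Mapping.lookup m V1
          = a1 * (- p) - a21 * (- q) - (int a1 - a21 - 1) * (- r)"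
        "int (Poly_Mapping.lookup m' V2) - Poly_Mapping.lookup m V2 = a2 * (- q) - (- r)"
        "int (Poly_Mapping.lookup m' V3) - Poly_Mapping.lookup m V3 = a3 * (- r) - (- p)"
        "int (Poly_Mapping.lookup m' V4) - Poly_Mapping.lookup m V4
          = - (int a4 - 1) * (- p) - (- q)"
        using d by (simp_all add: algebra_simps)
      assume "1 \<le> - p"
      then show False using no_positive[OF m(2,1) _ d'] by blast
    qed
    ultimately have p0: "p = 0" by simp
    note B = normal_bounds[OF m(1)] normal_bounds[OF m(2)]
    have r0: "r = 0"
    proof (rule ccontr)
      assume "r \<noteq> 0"
      then have "int a3 * 1 \<le> int a3 * \<bar>r\<bar>" by (intro mult_left_mono) auto
      then have "int a3 \<le> \<bar>?d V3\<bar>" unfolding d(3) p0 by (simp add: abs_mult)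
      then show False using B by linarith
    qed
    have q0: "q = 0"
    proof (rule ccontr)
      assume "q \<noteq> 0"
      then have "int a21 * 1 \<le> int a21 * \<bar>q\<bar>" by (intro mult_left_mono) auto
      moreover have "?d V1 = - (a21 * q)" "?d V4 = - q" using d p0 r0 by auto
      ultimately show False using B \<open>q \<noteq> 0\<close> by (cases "0 < q") auto
    qed
    show "m = m'"
    proof (rule poly_mapping_eqI)
      fix v show "Poly_Mapping.lookup m v = Poly_Mapping.lookup m' v"
        using d p0 q0 r0 by (cases v) auto
    qed
  qed
  show "\<exists>g\<in>G_set a1 a2 a3 a4 a21. (g :: 'a mpoly4) \<noteq> 0 \<and> (mon_dvd (LM lt g) m \<or> mon_dvd (LM lt g) m')"
    if "weight n m = weight n m'" "m \<noteq> m'" for m m'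
    using normal_unique[OF that(1)] that(2) unfolding normal_def leads_def by blast
qed

end

theorem theorem3p3:
  fixes n1 n2 n3 n4 :: nat
    and a1 a2 a3 a4 a21 :: nat
    and lt :: "mon \<Rightarrow> mon \<Rightarrow> bool"
  defines "n \<equiv> tuple n1 n2 n3 n4"
  assumes "0 < n1" and "n1 < n2" and "n2 < n3" and "n3 < n4"
    and "Gcd {n1, n2, n3, n4} = 1"
    and "minimally_generated n"
    and "pseudo_symmetric (semigroup_gen n UNIV)"
    and "komeda_parameters n a1 a2 a3 a4 a21"
    and "a2 > a21 + 1"
    and "local_degree_ordering lt"
    and "\<And>j i. j \<le> a4 - 1 \<Longrightarrow> i < s_num a1 a2 a3 a4 a21 j \<Longrightarrow>
           LM lt (g a1 a2 a3 a4 a21 j i :: 'a::alg_closed_field mpoly4)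
           = Poly_Mapping.single V1 (g_exp1 a1 a2 a3 a4 a21 j i)
             + Poly_Mapping.single V3 (a3 - (i + 1))"
  shows "standard_basis lt (toric_ideal n :: 'a mpoly4 set) (G_set a1 a2 a3 a4 a21)"
proof -
  interpret komeda_semigroup n a1 a2 a3 a4 a21
  proof
    show "komeda_parameters n a1 a2 a3 a4 a21" by fact
    show "a21 + 1 < a2" by fact
  qed (simp_all only: n_def tuple.simps assms(2-6))
  show ?thesis
  proof (rule standard_basis_G_set[OF \<open>local_degree_ordering lt\<close>], intro allI impI)
    fix j i assume "j \<le> a4 - 1" "i < s_num a1 a2 a3 a4 a21 j"
    note assms(12)[OF this]
    also have "Poly_Mapping.single V1 (g_exp1 a1 a2 a3 a4 a21 j i) + Poly_Mapping.single V3 (a3 - (i + 1))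
      = mon4 (g_exp1 a1 a2 a3 a4 a21 j i) 0 (a3 - (i + 1)) 0"
      by (simp only: mon4_def single_zero add_0_right)
    finally show "LM lt (g a1 a2 a3 a4 a21 j i :: 'a mpoly4)
      = mon4 (g_exp1 a1 a2 a3 a4 a21 j i) 0 (a3 - (i + 1)) 0" .
  qed
qed

end
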